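(* The spectral representation formula for killed Brownian motion, i.e. the identity $$\frac{1}{2}\frac{1}{\sqrt{2\pi t}}\sum_{n=-\infty}^{\infty}\left(e^{-\frac{(x-y+4n)^2}{2t}}-e^{-\frac{(x+y+4n+2)^2}{2t}}\right)=\frac12\sum_{n=1}^{\infty}e^{-\frac{n^2\pi^2}{8}t}\sin\left(\frac{n\pi(x+1)}{2}\right)\sin\left(\frac{n\pi(y+1)}{2}\right)$$ for all $x,y\in\mathbb{R}$ and $t>0$, implies the first modular identity: for all $t>0$ and $z\in\mathbb{C}$, $$\sqrt{t}\sum_{n=0}^\infty(-1)^n e^{-\pi t(n+\frac12)^2}\sin\left((2n+1)z\right)=e^{-\frac{z^2}{\pi t}}\sum_{n=0}^\infty(-1)^n e^{-\frac{\pi}{t}(n+\frac12)^2}\sinh\left((2n+1)\frac{z}{t}\right).$$ *)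

theory Defs
  imports "HOL-Analysis.Analysis"
begin

end

theory Submission
  imports Defs "HOL-Complex_Analysis.Complex_Analysis"
begin

text \<open>Putting y = 0 in the spectral formula kills the even modes and turns the factor
  sin (n * pi * (y + 1) / 2) into the alternating sign. With x replaced by 2 * x / pi - 1 and the
  time by 2 * t / pi the modal sum becomes the left-hand side of the modular identity, while
  completing the square in the image charges leaves a sum over all integers, whose terms j and
  - 1 - j combine to hyperbolic sines. This gives the identity for real arguments; both sides are
  entire, hence it holds on the complex plane.\<close>

text \<open>One term shape serves both sides of the modular identity: the left series has
  \<open>a = pi * t\<close> at \<open>z\<close>, and the right one is \<open>- \<i>\<close> times
  the series with \<open>a = pi / t\<close> at \<open>\<i> * z / t\<close>, because sinh w = - i sin
  (i w). Convergence and holomorphy are thus proved only once.\<close>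

definition theta_term :: "real \<Rightarrow> complex \<Rightarrow> nat \<Rightarrow> complex" where
  "theta_term a z n = (-1) ^ n * complex_of_real (exp (- (a * (real n + 1 / 2)\<^sup>2)))
     * sin (of_nat (2 * n + 1) * z)"

section \<open>Convergence and holomorphy of the theta series\<close>

lemma norm_sin_le_exp: "norm (sin z) \<le> exp (norm z)" for z :: complex
proof -
  have "norm (sin z) = norm (exp (\<i> * z) - exp (- (\<i> * z))) / 2"
    by (simp add: sin_exp_eq norm_divide norm_mult)
  also have "\<dots> \<le> (norm (exp (\<i> * z)) + norm (exp (- (\<i> * z)))) / 2"
    by (intro divide_right_mono norm_triangle_ineq4) simp
  also have "\<dots> \<le> (exp (norm z) + exp (norm z)) / 2"
    using norm_exp[of "\<i> * z"] norm_exp[of "- (\<i> * z)"]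
    by (intro divide_right_mono add_mono) (simp_all only: norm_mult norm_minus_cancel norm_ii mult_1 zero_le_numeral)
  finally show ?thesis by simp
qed

text \<open>Gaussian decay beats any linear exponent. The terms serve as a majorant of
  \<open>theta_term a z\<close> for all z with norm at most R, both for pointwise summability and
  for the Weierstrass M-test.\<close>

lemma summable_gaussian_exp:
  fixes a R :: real
  assumes "a > 0"
  shows "summable (\<lambda>n. exp (- (a * (real n + 1 / 2)\<^sup>2)) * exp ((2 * real n + 1) * R))"
proof (rule summable_comparison_test')
  \<comment> \<open>C is the maximum over real u of (2 R + 1) u - a u^2. With u = n + 1/2 this
    bounds the exponent by C - u, hence by C - n, which leaves a geometric series of ratio exp
    (-1).\<close>
  define C where "C = (2 * R + 1)\<^sup>2 / (4 * a)"
  show "summable (\<lambda>n. exp C * exp (- 1 :: real) ^ n)"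
    by (intro summable_mult summable_geometric) simp
  fix n :: nat
  have "- (a * u\<^sup>2) + 2 * u * R \<le> C - u" for u
  proof -
    have "C - u + a * u\<^sup>2 - 2 * u * R = (2 * a * u - (2 * R + 1))\<^sup>2 / (4 * a)"
      using assms by (simp add: C_def field_simps power2_eq_square)
    also have "\<dots> \<ge> 0" using assms by simp
    finally show ?thesis by linarith
  qed
  from this[of "real n + 1 / 2"]
  have "- (a * (real n + 1 / 2)\<^sup>2) + (2 * real n + 1) * R \<le> C - real n"
    by (simp add: algebra_simps)
  hence "exp (- (a * (real n + 1 / 2)\<^sup>2) + (2 * real n + 1) * R) \<le> exp (C + real n * (- 1))"
    by simp
  thus "norm (exp (- (a * (real n + 1 / 2)\<^sup>2)) * exp ((2 * real n + 1) * R))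
      \<le> exp C * exp (- 1) ^ n"
    unfolding exp_add exp_of_nat_mult by simp
qed

lemma norm_theta_term_le:
  assumes "norm z \<le> R"
  shows "norm (theta_term a z n)
    \<le> exp (- (a * (real n + 1 / 2)\<^sup>2)) * exp ((2 * real n + 1) * R)"
proof -
  have "norm (sin (of_nat (2 * n + 1) * z)) \<le> exp (norm (of_nat (2 * n + 1) * z))"
    by (rule norm_sin_le_exp)
  also have "norm (of_nat (2 * n + 1) * z) = (2 * real n + 1) * norm z"
    unfolding norm_mult norm_of_nat by simp
  also have "exp \<dots> \<le> exp ((2 * real n + 1) * R)"
    using assms by (simp add: mult_left_mono)
  finally show ?thesis
    by (simp add: theta_term_def norm_mult norm_power)
qed

lemma summable_theta_term: "a > 0 \<Longrightarrow> summable (theta_term a z)"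
  by (rule summable_comparison_test'[OF summable_gaussian_exp norm_theta_term_le[OF order_refl]])

text \<open>The partial sums are entire and converge uniformly on the closed unit ball around each
  x, since every point there has norm at most norm x + 1 and the majorant with that radius is
  summable.\<close>

lemma holomorphic_theta_series:
  assumes "a > 0"
  shows "(\<lambda>z. \<Sum>n. theta_term a z n) holomorphic_on UNIV"
proof (rule holomorphic_uniform_sequence[where f = "\<lambda>N z. \<Sum>n<N. theta_term a z n"])
  show "(\<lambda>z. \<Sum>n<N. theta_term a z n) holomorphic_on UNIV" for N
    unfolding theta_term_def by (intro holomorphic_intros)
  show "\<exists>d>0. cball x d \<subseteq> UNIV \<and> uniform_limit (cball x d)
      (\<lambda>N z. \<Sum>n<N. theta_term a z n) (\<lambda>z. \<Sum>n. theta_term a z n) sequentially" for x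
  proof (intro exI[of _ 1] conjI)
    show "uniform_limit (cball x 1)
      (\<lambda>N z. \<Sum>n<N. theta_term a z n) (\<lambda>z. \<Sum>n. theta_term a z n) sequentially"
    proof (rule Weierstrass_m_test[OF _ summable_gaussian_exp[OF assms]])
      fix n z assume "z \<in> cball x 1"
      hence "norm z \<le> norm x + 1"
        using norm_triangle_ineq2[of z x] by (simp add: dist_norm norm_minus_commute)
      thus "norm (theta_term a z n)
          \<le> exp (- (a * (real n + 1 / 2)\<^sup>2)) * exp ((2 * real n + 1) * (norm x + 1))"
        by (rule norm_theta_term_le)
    qed
  qed auto
qed auto

section \<open>Rearranging the image charges\<close>

lemma has_sum_int_split:
  fixes f :: "int \<Rightarrow> 'a :: topological_comm_monoid_add"
  assumes "((\<lambda>n. f (int n)) has_sum a) UNIV" "((\<lambda>n. f (- 1 - int n)) has_sum b) UNIV"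
  shows "(f has_sum (a + b)) UNIV"
proof -
  have neg: "range (\<lambda>n. - 1 - int n) = {..<0}"
  proof (intro equalityI subsetI)
    fix k :: int assume "k \<in> {..<0}"
    hence "k = - 1 - int (nat (- 1 - k))" by simp
    thus "k \<in> range (\<lambda>n. - 1 - int n)" by blast
  qed auto
  have pos: "range int = {0..}"
    by (auto simp: image_def intro: nonneg_int_cases)
  have "(f has_sum a) {0..}"
    using assms(1) has_sum_reindex[of int UNIV f a] by (simp add: pos o_def)
  moreover have "(f has_sum b) {..<0}"
    using assms(2) has_sum_reindex[of "\<lambda>n. - 1 - int n" UNIV f b]
    by (simp add: neg o_def inj_on_def)
  ultimately have "(f has_sum (a + b)) ({0..} \<union> {..<0})"
    by (intro has_sum_Un_disjoint) auto
  moreover have "{0..} \<union> {..<0} = (UNIV :: int set)" by auto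
  ultimately show ?thesis by simp
qed

text \<open>In a Banach space unconditional summability passes to the odd and the even indices,
  which are then reparametrised separately. The pairing turns a sum over single half-integer centres
  into the sum over pairs of images that occurs in the spectral formula.\<close>

lemma has_sum_int_pairs:
  fixes f :: "int \<Rightarrow> 'a :: banach"
  assumes "(f has_sum s) UNIV"
  shows "((\<lambda>n. f (2 * n - 1) + f (2 * n)) has_sum s) UNIV"
proof -
  have evens: "range (\<lambda>n. 2 * n) = {k::int. even k}" by auto
  have odds: "range (\<lambda>n. 2 * n - 1) = {k::int. odd k}"
  proof (intro equalityI subsetI)
    fix k :: int assume "k \<in> {k. odd k}"
    then obtain m where "k = 2 * m + 1" by (auto elim: oddE)
    hence "k = 2 * (m + 1) - 1" by simp
    thus "k \<in> range (\<lambda>n. 2 * n - 1)" by blast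
  qed auto
  have "f summable_on A" for A
    using assms summable_on_subset_banach[of f UNIV A] by (auto simp: summable_on_def)
  then obtain a b where ab: "(f has_sum a) {k. odd k}" "(f has_sum b) {k. even k}"
    unfolding summable_on_def by blast
  have "(f has_sum (a + b)) ({k. odd k} \<union> {k. even k})"
    using ab by (intro has_sum_Un_disjoint) auto
  moreover have "{k. odd k} \<union> {k. even k} = (UNIV :: int set)" by auto
  ultimately have "s = a + b"
    using assms infsumI by metis
  moreover have "((\<lambda>n. f (2 * n - 1)) has_sum a) UNIV"
    using ab(1) has_sum_reindex[of "\<lambda>n. 2 * n - 1" UNIV f a]
    by (simp add: odds o_def inj_on_def)
  moreover have "((\<lambda>n. f (2 * n)) has_sum b) UNIV"
    using ab(2) has_sum_reindex[of "\<lambda>n. 2 * n" UNIV f b]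
    by (simp add: evens o_def inj_on_def)
  ultimately show ?thesis
    by (simp add: has_sum_add)
qed

text \<open>The images of both signs are the odd and even members of one alternating series over the
  integers. Folding that series about -1/2 pairs exponentials of opposite argument into hyperbolic
  sines.\<close>

lemma has_sum_image_charges:
  fixes t z :: real
  assumes "t > 0"
  shows "((\<lambda>n::int. exp (- ((4 * real_of_int n - 1) * z / t) - pi / t * (2 * real_of_int n - 1 / 2)\<^sup>2)
         - exp (- ((4 * real_of_int n + 1) * z / t) - pi / t * (2 * real_of_int n + 1 / 2)\<^sup>2))
    has_sum (2 * (\<Sum>n. (-1) ^ n * exp (- (pi / t * (real n + 1 / 2)\<^sup>2))
                     * sinh ((2 * real n + 1) * (z / t))))) UNIV"
proof -
  define e where "e n = exp (- (pi / t * (real n + 1 / 2)\<^sup>2))" for n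
  \<comment> \<open>\<open>h (2 * n - 1)\<close> is the positive image and \<open>h (2 * n)\<close>
    the negative one, so the n-th summand of the claim is their sum.\<close>
  define h where "h j = - (if even j then 1 else - 1) *
    exp (- ((2 * real_of_int j + 1) * z / t) - pi / t * (real_of_int j + 1 / 2)\<^sup>2)" for j :: int
  define p where "p c n = (-1) ^ n * (e n * exp ((2 * real n + 1) * c))" for c n
  have summable_p: "summable (\<lambda>n. norm (p c n))" for c
    using summable_gaussian_exp[of "pi / t" c] assms
    by (simp add: p_def e_def abs_mult power_abs)
  have p_sum: "(p c has_sum suminf (p c)) UNIV" for c
    by (rule norm_summable_imp_has_sum[OF summable_p])
       (rule summable_sums[OF summable_norm_cancel[OF summable_p]])
  have h_pos: "h (int n) = - p (- z / t) n" for n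
    by (simp add: h_def p_def e_def minus_one_power_iff flip: exp_add)
  \<comment> \<open>The reflection j -> -1 - j keeps (j + 1/2)^2, negates 2 j + 1 and flips the
    parity of j. So the two halves of the series differ only in overall sign and in the sign of
    z.\<close>
  have "(real_of_int (- 1 - int n) + 1 / 2)\<^sup>2 = (real n + 1 / 2)\<^sup>2" for n
    by (simp add: power2_eq_square algebra_simps)
  moreover have "- ((2 * real_of_int (- 1 - int n) + 1) * z / t) = (2 * real n + 1) * (z / t)" for n
    using assms by (simp add: field_simps)
  ultimately have h_neg: "h (- 1 - int n) = p (z / t) n" for n
    unfolding h_def p_def e_def
    by (simp add: minus_one_power_iff exp_diff exp_minus field_simps)
  have "(h has_sum (- suminf (p (- z / t)) + suminf (p (z / t)))) UNIV"
    by (intro has_sum_int_split; simp only: h_pos h_neg has_sum_uminus minus_minus p_sum)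
  moreover have "- suminf (p (- z / t)) + suminf (p (z / t))
      = (\<Sum>n. 2 * ((-1) ^ n * e n * sinh ((2 * real n + 1) * (z / t))))"
  proof -
    have "- suminf (p (- z / t)) + suminf (p (z / t)) = (\<Sum>n. p (z / t) n - p (- z / t) n)"
      using suminf_diff[of "p (z / t)" "p (- z / t)"] summable_norm_cancel[OF summable_p] by simp
    also have "(\<lambda>n. p (z / t) n - p (- z / t) n)
        = (\<lambda>n. 2 * ((-1) ^ n * e n * sinh ((2 * real n + 1) * (z / t))))"
      by (simp add: p_def sinh_field_def algebra_simps fun_eq_iff)
    finally show ?thesis .
  qed
  moreover have "summable (\<lambda>n. (-1) ^ n * e n * sinh ((2 * real n + 1) * (z / t)))"
  proof -
    have "summable (\<lambda>n. (p (z / t) n - p (- z / t) n) / 2)"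
      by (intro summable_divide summable_diff summable_norm_cancel[OF summable_p])
    also have "(\<lambda>n. (p (z / t) n - p (- z / t) n) / 2)
        = (\<lambda>n. (-1) ^ n * e n * sinh ((2 * real n + 1) * (z / t)))"
      by (simp add: p_def sinh_field_def algebra_simps fun_eq_iff)
    finally show ?thesis .
  qed
  ultimately have "(h has_sum (2 * (\<Sum>n. (-1) ^ n * e n * sinh ((2 * real n + 1) * (z / t))))) UNIV"
    by (simp add: suminf_mult)
  from has_sum_int_pairs[OF this]
  show ?thesis
    by (simp add: h_def e_def algebra_simps)
qed

section \<open>From the spectral formula to the modular identity\<close>

lemma suminf_odd:
  fixes c :: "nat \<Rightarrow> real"
  assumes "\<And>k. odd k \<Longrightarrow> c k = 0"
  shows "suminf c = (\<Sum>m. c (2 * m))"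
  by (rule suminf_mono_reindex[of "\<lambda>m. 2 * m", symmetric])
     (use assms in \<open>auto simp: strict_mono_def image_iff elim: evenE\<close>)

lemma sinh_eq_sin: "sinh z = - \<i> * sin (\<i> * z)" for z :: complex
  by (simp add: sin_exp_eq sinh_field_def field_simps)

theorem theorem4p1:
  assumes spectral:
    "\<forall>(x::real) (y::real) (t::real). t > 0 \<longrightarrow>
       1 / 2 * (1 / sqrt (2 * pi * t)) *
         (\<Sum>\<^sub>\<infinity>n\<in>(UNIV :: int set).
            exp (- ((x - y + 4 * of_int n)\<^sup>2 / (2 * t)))
            - exp (- ((x + y + 4 * of_int n + 2)\<^sup>2 / (2 * t))))
       = 1 / 2 * (\<Sum>k. let n = real (Suc k) in
            exp (- (n\<^sup>2 * pi\<^sup>2 / 8 * t))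
            * sin (n * pi * (x + 1) / 2) * sin (n * pi * (y + 1) / 2))"
  shows
    "\<forall>(t::real) (z::complex). t > 0 \<longrightarrow>
       (let f = (\<lambda>n::nat. (-1) ^ n * complex_of_real (exp (- (pi * t * (real n + 1 / 2)\<^sup>2)))
                   * sin (of_nat (2 * n + 1) * z));
            g = (\<lambda>n::nat. (-1) ^ n * complex_of_real (exp (- (pi / t * (real n + 1 / 2)\<^sup>2)))
                   * sinh (of_nat (2 * n + 1) * (z / complex_of_real t)))
        in summable f \<and> summable g \<and>
           complex_of_real (sqrt t) * (\<Sum>n. f n)
           = exp (- (z\<^sup>2 / complex_of_real (pi * t))) * (\<Sum>n. g n))"
proof (intro allI impI)
  fix t :: real and z :: complex
  assume t: "t > 0"
  define F where "F w = (\<Sum>n. theta_term (pi * t) w n)" for w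
  define G where "G w = (\<Sum>n. theta_term (pi / t) (\<i> * w / of_real t) n)" for w
  \<comment> \<open>D is the left side minus the right side: the hyperbolic series at w is
    \<open>- \<i> * G w\<close>, hence the plus sign before \<open>\<i>\<close>.\<close>
  define D where "D w = of_real (sqrt t) * F w + \<i> * exp (- (w\<^sup>2 / of_real (pi * t))) * G w" for w
  have real_case: "D (of_real x) = 0" for x :: real
  proof -
    let ?f = "\<lambda>n. (-1) ^ n * exp (- (pi * t * (real n + 1 / 2)\<^sup>2)) * sin ((2 * real n + 1) * x)"
    let ?g = "\<lambda>n. (-1) ^ n * exp (- (pi / t * (real n + 1 / 2)\<^sup>2)) * sinh ((2 * real n + 1) * (x / t))"
    \<comment> \<open>\<open>?x\<close> is chosen so that n pi (\<open>?x\<close> + 1) / 2 = n x,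
      and \<open>?T\<close> so that n^2 pi^2 \<open>?T\<close> / 8 = pi t (n/2)^2, which is the
      required Gaussian exponent for n = 2 m + 1.\<close>
    let ?x = "2 * x / pi - 1" and ?T = "2 * t / pi"
    have fterm: "theta_term (pi * t) (of_real x) n = of_real (?f n)" for n
      by (simp add: theta_term_def add.commute flip: sin_of_real)
    have gterm: "- \<i> * theta_term (pi / t) (\<i> * of_real x / of_real t) n = of_real (?g n)" for n
    proof -
      have "complex_of_real (sinh ((2 * real n + 1) * (x / t)))
          = sinh (of_real ((2 * real n + 1) * (x / t)))"
        unfolding sinh_field_def of_real_divide of_real_diff exp_of_real[symmetric] of_real_minus
        by simp
      also have "\<dots> = - \<i> * sin (of_nat (2 * n + 1) * (\<i> * of_real x / of_real t))"
        unfolding sinh_eq_sin by (simp add: algebra_simps)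
      finally show ?thesis by (simp add: theta_term_def)
    qed
    have sf: "summable (theta_term (pi * t) (of_real x))"
      and sg: "summable (theta_term (pi / t) (\<i> * of_real x / of_real t))"
      using t by (simp_all add: summable_theta_term)
    have "summable ?f" using sf unfolding fterm by (simp only: summable_complex_of_real)
    hence F: "F (of_real x) = of_real (suminf ?f)"
      unfolding F_def fterm by (rule suminf_of_real[symmetric])
    have "summable (\<lambda>n. complex_of_real (?g n))"
      using summable_mult[OF sg, of "- \<i>"] unfolding gterm .
    hence "summable ?g" by (simp only: summable_complex_of_real)
    hence "of_real (suminf ?g) = (\<Sum>n. complex_of_real (?g n))"
      by (rule suminf_of_real)
    also have "\<dots> = - \<i> * G (of_real x)"
      unfolding G_def suminf_mult[OF sg, symmetric] gterm ..
    finally have G: "\<i> * G (of_real x) = - of_real (suminf ?g)" by simp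
    have cancel_half: "1 / 2 * a * b = 1 / 2 * c \<Longrightarrow> a * b = c" for a b c :: real
      by simp
    have "?T > 0" using t by simp
    from spectral[rule_format, OF this, of ?x 0]
    have spec: "1 / sqrt (2 * pi * ?T) *
         (\<Sum>\<^sub>\<infinity>n\<in>(UNIV :: int set).
            exp (- ((?x - 0 + 4 * of_int n)\<^sup>2 / (2 * ?T)))
            - exp (- ((?x + 0 + 4 * of_int n + 2)\<^sup>2 / (2 * ?T))))
       = (\<Sum>k. exp (- ((real (Suc k))\<^sup>2 * pi\<^sup>2 / 8 * ?T))
            * sin (real (Suc k) * pi * (?x + 1) / 2) * sin (real (Suc k) * pi * (0 + 1) / 2))"
      (is "_ * ?L = suminf ?R")
      unfolding Let_def by (rule cancel_half)
    \<comment> \<open>The index k stands for the mode k + 1, so odd k are the even modes, where the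
      sine factor from y = 0 vanishes. At k = 2 m that factor is sin (pi/2 + m pi) = (-1)^m.\<close>
    have "suminf ?R = (\<Sum>m. ?R (2 * m))"
    proof (rule suminf_odd)
      fix k :: nat assume "odd k"
      then obtain m where "Suc k = 2 * m" by (metis evenE even_Suc)
      hence "real (Suc k) * pi * (0 + 1) / 2 = real m * pi" by simp
      thus "?R k = 0" by simp
    qed
    also have "(\<lambda>m. ?R (2 * m)) = ?f"
    proof
      fix m :: nat
      have "real (Suc (2 * m)) * pi * (0 + 1) / 2 = pi / 2 + real m * pi"
        by (simp add: field_simps)
      hence 1: "sin (real (Suc (2 * m)) * pi * (0 + 1) / 2) = (-1) ^ m"
        by (simp only: sin_add) simp
      have 2: "real (Suc (2 * m)) * pi * (?x + 1) / 2 = (2 * real m + 1) * x"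
        by (simp add: field_simps)
      have 3: "(real (Suc (2 * m)))\<^sup>2 * pi\<^sup>2 / 8 * ?T = pi * t * (real m + 1 / 2)\<^sup>2"
        by (simp add: field_simps power2_eq_square)
      show "?R (2 * m) = ?f m" unfolding 1 2 3 by simp
    qed
    finally have R: "suminf ?R = suminf ?f" .
    \<comment> \<open>Both squares have the form (2 x / pi + c)^2 with c = 4 n - 1 or 4 n + 1.
      Expanding them separates the factor exp (- x^2 / (pi t)), common to all images, from a linear
      term c x / t and a Gaussian in c / 2.\<close>
    have "exp (- ((?x - 0 + 4 * of_int n)\<^sup>2 / (2 * ?T)))
            - exp (- ((?x + 0 + 4 * of_int n + 2)\<^sup>2 / (2 * ?T)))
        = exp (- (x\<^sup>2 / (pi * t))) *
           (exp (- ((4 * real_of_int n - 1) * x / t) - pi / t * (2 * real_of_int n - 1 / 2)\<^sup>2)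
         - exp (- ((4 * real_of_int n + 1) * x / t) - pi / t * (2 * real_of_int n + 1 / 2)\<^sup>2))" for n
    proof -
      have 1: "- ((?x - 0 + 4 * of_int n)\<^sup>2 / (2 * ?T)) = - (x\<^sup>2 / (pi * t)) +
          (- ((4 * real_of_int n - 1) * x / t) - pi / t * (2 * real_of_int n - 1 / 2)\<^sup>2)"
        using t by (simp add: field_simps power2_eq_square)
      have 2: "- ((?x + 0 + 4 * of_int n + 2)\<^sup>2 / (2 * ?T)) = - (x\<^sup>2 / (pi * t)) +
          (- ((4 * real_of_int n + 1) * x / t) - pi / t * (2 * real_of_int n + 1 / 2)\<^sup>2)"
        using t by (simp add: field_simps power2_eq_square)
      show ?thesis unfolding 1 2 exp_add by (simp add: algebra_simps)
    qed
    \<comment> \<open>The image sum is known to converge here, so \<open>infsum\<close> is its true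
      value and not the default 0. The factor 2 cancels against the 2 in the square root computed
      next.\<close>
    hence L: "?L = exp (- (x\<^sup>2 / (pi * t))) * (2 * suminf ?g)"
      using has_sum_cmult_right[OF has_sum_image_charges[OF t, of x], of "exp (- (x\<^sup>2 / (pi * t)))"]
      by (simp only: infsumI)
    have "sqrt (2 * pi * ?T) = 2 * sqrt t"
      by (simp add: real_sqrt_mult)
    hence "suminf ?f = 1 / sqrt t * (exp (- (x\<^sup>2 / (pi * t))) * suminf ?g)"
      using spec unfolding L R by simp
    hence "sqrt t * suminf ?f = exp (- (x\<^sup>2 / (pi * t))) * suminf ?g"
      using t by simp
    hence "of_real (sqrt t) * complex_of_real (suminf ?f)
        = of_real (exp (- (x\<^sup>2 / (pi * t)))) * of_real (suminf ?g)"
      by (simp only: flip: of_real_mult)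
    moreover have "complex_of_real (exp (- (x\<^sup>2 / (pi * t))))
        = exp (- ((of_real x)\<^sup>2 / of_real (pi * t)))"
      by (simp flip: exp_of_real)
    moreover have "D (of_real x) = of_real (sqrt t) * F (of_real x)
        + exp (- ((of_real x)\<^sup>2 / of_real (pi * t))) * (\<i> * G (of_real x))"
      by (simp add: D_def)
    ultimately show ?thesis
      unfolding F G by simp
  qed
  have D_holo: "D holomorphic_on UNIV"
  proof -
    have F: "F holomorphic_on UNIV"
      unfolding F_def using t by (intro holomorphic_theta_series) simp
    have "(\<lambda>w. \<Sum>n. theta_term (pi / t) w n) \<circ> (\<lambda>w. \<i> * w / of_real t) holomorphic_on UNIV"
      by (rule holomorphic_on_compose_gen[of _ _ _ UNIV])
         (use t in \<open>auto intro!: holomorphic_intros holomorphic_theta_series\<close>)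
    hence "G holomorphic_on UNIV" by (simp add: G_def[abs_def] o_def)
    with F show ?thesis
      unfolding D_def using t by (intro holomorphic_intros) auto
  qed
  \<comment> \<open>The identity theorem asks for an accumulation point of the zeros of D; the real
    line provides 0.\<close>
  have limpt: "(0::complex) islimpt \<real>"
    unfolding islimpt_approachable
  proof (intro allI impI)
    fix e :: real assume "e > 0"
    thus "\<exists>w\<in>\<real>. w \<noteq> 0 \<and> dist w (0::complex) < e"
      by (intro bexI[of _ "of_real (e / 2)"]) auto
  qed
  have "D z = 0"
    by (rule analytic_continuation[OF D_holo _ _ _ _ limpt]) (auto simp: Reals_def real_case)
  \<comment> \<open>Summability at complex z comes directly from the majorant; only the equality of
    the sums uses continuation from the real line.\<close>
  moreover have f: "(-1) ^ n * complex_of_real (exp (- (pi * t * (real n + 1 / 2)\<^sup>2)))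
      * sin (of_nat (2 * n + 1) * z) = theta_term (pi * t) z n" for n
    by (simp add: theta_term_def)
  moreover have g: "(-1) ^ n * complex_of_real (exp (- (pi / t * (real n + 1 / 2)\<^sup>2)))
      * sinh (of_nat (2 * n + 1) * (z / complex_of_real t))
      = - \<i> * theta_term (pi / t) (\<i> * z / of_real t) n" for n
    unfolding sinh_eq_sin theta_term_def by (simp add: algebra_simps)
  moreover have sf: "summable (theta_term (pi * t) z)"
    and sg: "summable (theta_term (pi / t) (\<i> * z / of_real t))"
    using t by (simp_all add: summable_theta_term)
  ultimately show "let f = (\<lambda>n::nat. (-1) ^ n * complex_of_real (exp (- (pi * t * (real n + 1 / 2)\<^sup>2)))
                   * sin (of_nat (2 * n + 1) * z));
            g = (\<lambda>n::nat. (-1) ^ n * complex_of_real (exp (- (pi / t * (real n + 1 / 2)\<^sup>2)))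
                   * sinh (of_nat (2 * n + 1) * (z / complex_of_real t)))
        in summable f \<and> summable g \<and>
           complex_of_real (sqrt t) * (\<Sum>n. f n)
           = exp (- (z\<^sup>2 / complex_of_real (pi * t))) * (\<Sum>n. g n)"
    unfolding Let_def f g
    using summable_mult[OF sg, of "- \<i>"] suminf_mult[OF sg, of "- \<i>"]
    by (auto simp: D_def F_def G_def add_eq_0_iff2)
qed

end
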